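(* Let $n \geq 5$, and suppose $\mathcal{B}$ is a cycle $M$-basis for the complete graph $K_n$. Then at least one element of $\mathcal{B}$ has more than $3$ nonzero entries (so that at least one of the cycles is not a triangle).
   Context: Let $G=(V,E)$ be a finite connected undirected simple graph with a fixed orientation of its edges, and let $\partial : \mathbb{R}^E \to \mathbb{R}^V$ be the signed incidence matrix: the column of an edge has an entry $-1$ in the row of one endpoint and $+1$ in the row of the other endpoint (according to the orientation), and $0$ elsewhere. The lattice of integral flows of $G$ is $\mathcal{F}(G) = \mathbb{Z}^E \cap \ker(\partial)$, a free abelian group of rank $g = |E|-|V|+1$. Given a $\mathbb{Z}$-basis $\mathcal{B} = \{\mathbf{f}_1,\dots,\mathbf{f}_g\}$ of $\mathcal{F}(G)$, let $\iota$ be the $|E|\times g$ matrix with columns $\mathbf{f}_1,\dots,\mathbf{f}_g$; the associated dual Laplacian is $\mathcal{L}^* = \iota^T\iota$. An $n\times n$ matrix $L$ is a $Z$-matrix if $L_{ij}\le 0$ for all $i\ne j$. A $Z$-matrix $L$ is a (non-singular) $M$-matrix if all eigenvalues of $L$ have positive real part (equivalently, $L^{-1}$ exists and has all entries non-negative). $\mathcal{B}$ is an integral flow $M$-basis if $\mathcal{L}^*$ is an $M$-matrix. A cycle $M$-basis for $G$ is an integral flow $M$-basis each of whose elements encodes a directed (simple) cycle of $G$: all entries are in $\{0,1,-1\}$, the nonzero entries are exactly those at the edges of some simple cycle of $G$, and the signs are determined by comparing a cyclic orientation of that cycle with the fixed orientation of $G$ ($+1$ if they agree on the edge, $-1$ if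 they disagree). *)

theory Defs
  imports "HOL-Analysis.Analysis"
begin

(* A graph with vertex set UNIV :: 'v set and edge set UNIV :: 'e set, together with an
   orientation, is given by the endpoint maps tail, head :: 'e => 'v: the edge e joins tail e
   and head e and is oriented from tail e to head e. *)

definition adjacent :: "('e::finite \<Rightarrow> 'v::finite) \<Rightarrow> ('e \<Rightarrow> 'v) \<Rightarrow> 'v \<Rightarrow> 'v \<Rightarrow> bool" where
  "adjacent tail head u v \<longleftrightarrow> (\<exists>e. {tail e, head e} = {u, v})"

definition simple_graph :: "('e::finite \<Rightarrow> 'v::finite) \<Rightarrow> ('e \<Rightarrow> 'v) \<Rightarrow> bool" where
  "simple_graph tail head \<longleftrightarrow>
     (\<forall>e. tail e \<noteq> head e) \<and>
     (\<forall>e e'. {tail e, head e} = {tail e', head e'} \<longrightarrow> e = e')"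

definition connected_graph :: "('e::finite \<Rightarrow> 'v::finite) \<Rightarrow> ('e \<Rightarrow> 'v) \<Rightarrow> bool" where
  "connected_graph tail head \<longleftrightarrow> (\<forall>u v. (adjacent tail head)\<^sup>*\<^sup>* u v)"

definition complete_graph :: "('e::finite \<Rightarrow> 'v::finite) \<Rightarrow> ('e \<Rightarrow> 'v) \<Rightarrow> bool" where
  "complete_graph tail head \<longleftrightarrow>
     simple_graph tail head \<and> (\<forall>u v. u \<noteq> v \<longrightarrow> adjacent tail head u v)"

definition incidence_matrix :: "('e::finite \<Rightarrow> 'v::finite) \<Rightarrow> ('e \<Rightarrow> 'v) \<Rightarrow> real^'e^'v" where
  "incidence_matrix tail head =
     (\<chi> v e. if v = tail e then -1 else if v = head e then 1 else 0)"

definition flow_lattice :: "('e::finite \<Rightarrow> 'v::finite) \<Rightarrow> ('e \<Rightarrow> 'v) \<Rightarrow> (real^'e) set" where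
  "flow_lattice tail head =
     {x. (\<forall>e. x $ e \<in> \<int>) \<and> incidence_matrix tail head *v x = 0}"

interpretation int_module: module "\<lambda>(k::int) (x::'a::real_vector). of_int k *\<^sub>R x"
  by standard (simp_all add: algebra_simps)

definition flow_basis ::
  "('e::finite \<Rightarrow> 'v::finite) \<Rightarrow> ('e \<Rightarrow> 'v) \<Rightarrow> ('g::finite \<Rightarrow> real^'e) \<Rightarrow> bool" where
  "flow_basis tail head f \<longleftrightarrow>
     inj f \<and> int_module.independent (range f) \<and>
     int_module.span (range f) = flow_lattice tail head"

definition basis_matrix :: "('g::finite \<Rightarrow> real^'e::finite) \<Rightarrow> real^'g^'e" where
  "basis_matrix f = (\<chi> e i. f i $ e)"

definition dual_laplacian :: "('g::finite \<Rightarrow> real^'e::finite) \<Rightarrow> real^'g^'g" where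
  "dual_laplacian f = transpose (basis_matrix f) ** basis_matrix f"

definition complex_eigenvalue :: "real^'n^'n::finite \<Rightarrow> complex \<Rightarrow> bool" where
  "complex_eigenvalue A z \<longleftrightarrow>
     (\<exists>x::complex^'n. x \<noteq> 0 \<and> map_matrix complex_of_real A *v x = z *s x)"

definition Z_matrix :: "real^'n^'n::finite \<Rightarrow> bool" where
  "Z_matrix A \<longleftrightarrow> (\<forall>i j. i \<noteq> j \<longrightarrow> A $ i $ j \<le> 0)"

definition M_matrix :: "real^'n^'n::finite \<Rightarrow> bool" where
  "M_matrix A \<longleftrightarrow> Z_matrix A \<and> (\<forall>z. complex_eigenvalue A z \<longrightarrow> Re z > 0)"

definition flow_M_basis ::
  "('e::finite \<Rightarrow> 'v::finite) \<Rightarrow> ('e \<Rightarrow> 'v) \<Rightarrow> ('g::finite \<Rightarrow> real^'e) \<Rightarrow> bool" where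
  "flow_M_basis tail head f \<longleftrightarrow> flow_basis tail head f \<and> M_matrix (dual_laplacian f)"

(* The list vs is the cyclic sequence of the vertices of a simple cycle. *)
definition graph_cycle ::
  "('e::finite \<Rightarrow> 'v::finite) \<Rightarrow> ('e \<Rightarrow> 'v) \<Rightarrow> 'v list \<Rightarrow> bool" where
  "graph_cycle tail head vs \<longleftrightarrow>
     3 \<le> length vs \<and> distinct vs \<and>
     (\<forall>i<length vs. adjacent tail head (vs ! i) (vs ! (Suc i mod length vs)))"

(* The two conditions cannot hold for the same e: a simple cycle has at least three vertices,
   so no two of its steps are opposite to each other. *)
definition cycle_vector ::
  "('e::finite \<Rightarrow> 'v::finite) \<Rightarrow> ('e \<Rightarrow> 'v) \<Rightarrow> 'v list \<Rightarrow> real^'e" where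
  "cycle_vector tail head vs =
     (\<chi> e. if \<exists>i<length vs. tail e = vs ! i \<and> head e = vs ! (Suc i mod length vs) then 1
          else if \<exists>i<length vs. head e = vs ! i \<and> tail e = vs ! (Suc i mod length vs) then -1
          else 0)"

definition cycle_M_basis ::
  "('e::finite \<Rightarrow> 'v::finite) \<Rightarrow> ('e \<Rightarrow> 'v) \<Rightarrow> ('g::finite \<Rightarrow> real^'e) \<Rightarrow> bool" where
  "cycle_M_basis tail head f \<longleftrightarrow>
     flow_M_basis tail head f \<and>
     (\<forall>i. \<exists>vs. graph_cycle tail head vs \<and> f i = cycle_vector tail head vs)"

end

theory Submission
  imports Defs
begin

text \<open>
  Suppose all basis elements have at most three nonzero entries. A nonzero flow of a simple
  graph has at least three nonzero entries, and if it has exactly three, they agree in absolute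
  value. As distinct basis elements have nonpositive inner product, it follows that no two of them
  agree in sign on a common edge, so each edge lies in at most two of the supports, and the two
  contributions then cancel in the sum \<open>s\<close> of the basis. This \<open>s\<close> is a nonzero
  flow, so at least three edges are covered at most once, and counting incidences gives
  \<open>3 g + 3 \<le> 2 |E|\<close>. Since \<open>g \<ge> (n - 1) (n - 2) / 2\<close> (consider the triangles
  through a fixed vertex), this fails for \<open>n \<ge> 5\<close>.
\<close>

section \<open>Supports of flows in a simple graph\<close>

abbreviation supp :: "real^'e::finite \<Rightarrow> 'e set" where
  "supp x \<equiv> {e. x $ e \<noteq> 0}"

lemma incidence_matrix_eq_0_iff:
  "incidence_matrix tail head $ v $ e = 0 \<longleftrightarrow> v \<notin> {tail e, head e}"
  by (auto simp: incidence_matrix_def)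

lemma abs_incidence_matrix:
  "v \<in> {tail e, head e} \<Longrightarrow> \<bar>incidence_matrix tail head $ v $ e\<bar> = 1"
  by (auto simp: incidence_matrix_def)

lemma flow_sum_at_vertex:
  assumes "incidence_matrix tail head *v x = 0"
  shows "(\<Sum>e\<in>UNIV. incidence_matrix tail head $ v $ e * x $ e) = 0"
  using arg_cong[OF assms, of "\<lambda>y. y $ v"] by (simp add: matrix_vector_mult_def)

text \<open>If \<open>e\<close> were the only edge of the support at \<open>v\<close>, conservation
  at \<open>v\<close> would reduce to one nonzero term.\<close>

lemma flow_continues:
  assumes flow: "incidence_matrix tail head *v x = 0"
    and e: "x $ e \<noteq> 0" "v \<in> {tail e, head e}"
  obtains e' where "e' \<noteq> e" "x $ e' \<noteq> 0" "v \<in> {tail e', head e'}"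
proof -
  let ?I = "incidence_matrix tail head"
  have "\<exists>e'. e' \<noteq> e \<and> ?I $ v $ e' * x $ e' \<noteq> 0"
  proof (rule ccontr)
    assume "\<not> ?thesis"
    then have "(\<Sum>e'\<in>UNIV. ?I $ v $ e' * x $ e') = (\<Sum>e'\<in>{e}. ?I $ v $ e' * x $ e')"
      by (intro sum.mono_neutral_right) auto
    then have "?I $ v $ e * x $ e = 0"
      using flow_sum_at_vertex[OF flow] by simp
    then show False
      using e incidence_matrix_eq_0_iff[of tail head v e] by simp
  qed
  then show thesis
    using that incidence_matrix_eq_0_iff[of tail head v] by (metis mult_eq_0_iff)
qed

text \<open>The flow continues beyond both ends of \<open>e\<close>. As the graph is simple, no
  other edge joins these two ends, so each continuation misses the opposite end, and the two are
  different.\<close>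

lemma flow_support:
  assumes simple: "simple_graph tail head"
    and flow: "incidence_matrix tail head *v x = 0"
    and e: "x $ e \<noteq> 0"
  obtains e1 e2 where "e1 \<noteq> e" "e2 \<noteq> e" "e1 \<noteq> e2" "x $ e1 \<noteq> 0" "x $ e2 \<noteq> 0"
    "tail e \<in> {tail e1, head e1}" "head e \<notin> {tail e1, head e1}"
    "head e \<in> {tail e2, head e2}" "tail e \<notin> {tail e2, head e2}"
proof -
  obtain e1 where e1: "e1 \<noteq> e" "x $ e1 \<noteq> 0" "tail e \<in> {tail e1, head e1}"
    using flow_continues[OF flow e, of "tail e"] by auto
  obtain e2 where e2: "e2 \<noteq> e" "x $ e2 \<noteq> 0" "head e \<in> {tail e2, head e2}"
    using flow_continues[OF flow e, of "head e"] by auto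
  have parallel: "e' = e" if "{tail e, head e} \<subseteq> {tail e', head e'}" for e'
  proof -
    have "{tail e', head e'} = {tail e, head e}"
      using that simple[unfolded simple_graph_def, THEN conjunct1, rule_format, of e] by auto
    then show ?thesis
      using simple unfolding simple_graph_def by blast
  qed
  show thesis
    using that[of e1 e2] e1 e2 parallel[of e1] parallel[of e2] by blast
qed

lemma flow_card_supp_ge_3:
  assumes "simple_graph tail head" "incidence_matrix tail head *v x = 0" "x \<noteq> 0"
  shows "3 \<le> card (supp x)"
proof -
  obtain e where "x $ e \<noteq> 0"
    using assms(3) by (auto simp: vec_eq_iff)
  with assms(1,2) obtain e1 e2 where "e1 \<noteq> e" "e2 \<noteq> e" "e1 \<noteq> e2" "{e, e1, e2} \<subseteq> supp x"
    by (auto elim!: flow_support)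
  then show ?thesis
    using card_mono[of "supp x" "{e, e1, e2}"] by simp
qed

text \<open>The support is \<open>e\<close> with its two continuations. Exactly two of these three
  edges meet at each end of \<open>e\<close>, and conservation there forces their entries to be
  equal up to sign.\<close>

lemma flow_abs_eq:
  assumes simple: "simple_graph tail head"
    and flow: "incidence_matrix tail head *v x = 0"
    and card: "card (supp x) \<le> 3"
    and nz: "x $ e \<noteq> 0" "x $ e' \<noteq> 0"
  shows "\<bar>x $ e\<bar> = \<bar>x $ e'\<bar>"
proof -
  let ?I = "incidence_matrix tail head"
  obtain e1 e2 where ne: "e1 \<noteq> e" "e2 \<noteq> e" "e1 \<noteq> e2" and x: "x $ e1 \<noteq> 0" "x $ e2 \<noteq> 0"
    and inc: "tail e \<in> {tail e1, head e1}" "head e \<notin> {tail e1, head e1}"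
      "head e \<in> {tail e2, head e2}" "tail e \<notin> {tail e2, head e2}"
    using flow_support[OF simple flow nz(1)] by metis
  have supp: "{e, e1, e2} = supp x"
    using ne x nz card by (intro card_seteq) auto
  have sum: "?I $ v $ e * x $ e + ?I $ v $ e1 * x $ e1 + ?I $ v $ e2 * x $ e2 = 0" for v
  proof -
    have "(\<Sum>e\<in>UNIV. ?I $ v $ e * x $ e) = (\<Sum>e\<in>{e, e1, e2}. ?I $ v $ e * x $ e)"
      unfolding supp by (intro sum.mono_neutral_right) auto
    then show ?thesis
      using flow_sum_at_vertex[OF flow, of v] ne by (simp add: algebra_simps)
  qed
  have abs_eq: "\<bar>x $ a\<bar> = \<bar>x $ b\<bar>"
    if "?I $ v $ a * x $ a + ?I $ v $ b * x $ b = 0"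
      "v \<in> {tail a, head a}" "v \<in> {tail b, head b}" for a b v
  proof -
    have "\<bar>?I $ v $ a\<bar> * \<bar>x $ a\<bar> = \<bar>?I $ v $ b\<bar> * \<bar>x $ b\<bar>"
      using that(1) by (metis abs_minus abs_mult add_eq_0_iff)
    then show ?thesis
      using that(2,3) by (simp add: abs_incidence_matrix)
  qed
  have "\<bar>x $ e\<bar> = \<bar>x $ e1\<bar>"
    using sum[of "tail e"] inc incidence_matrix_eq_0_iff[of tail head "tail e" e2]
    by (intro abs_eq[of "tail e"]) auto
  moreover have "\<bar>x $ e\<bar> = \<bar>x $ e2\<bar>"
    using sum[of "head e"] inc incidence_matrix_eq_0_iff[of tail head "head e" e1]
    by (intro abs_eq[of "head e"]) auto
  moreover have "e' \<in> {e, e1, e2}"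
    using nz supp by simp
  ultimately show ?thesis
    by auto
qed

section \<open>Sign conflicts between short flows\<close>

text \<open>Agreement at \<open>e\<close> gives a positive term of the inner product, so some
  \<open>e'\<close> has a negative one, where \<open>x + y\<close> cancels. Then
  \<open>x + y\<close> is again short, and its nonzero entries all have the absolute value 2 found
  at \<open>e\<close>. This confines its support to that of \<open>x\<close> without
  \<open>e'\<close>, which is too small for a nonzero flow.\<close>

lemma short_flows_disagree:
  assumes simple: "simple_graph tail head"
    and x: "incidence_matrix tail head *v x = 0" "card (supp x) \<le> 3" "\<And>e. x $ e \<in> {-1, 0, 1}"
    and y: "incidence_matrix tail head *v y = 0" "card (supp y) \<le> 3" "\<And>e. y $ e \<in> {-1, 0, 1}"
    and le: "(\<Sum>e\<in>UNIV. x $ e * y $ e) \<le> 0"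
    and nz: "x $ e \<noteq> 0"
  shows "x $ e \<noteq> y $ e"
proof
  assume eq: "x $ e = y $ e"
  have "\<exists>e'. x $ e' * y $ e' < 0"
  proof (rule ccontr)
    assume "\<not> ?thesis"
    then have "0 < (\<Sum>e\<in>UNIV. x $ e * y $ e)"
      using eq nz by (intro sum_pos2[of UNIV e]) (auto simp: not_less zero_less_mult_iff)
    with le show False by simp
  qed
  then obtain e' where "x $ e' * y $ e' < 0" by blast
  with x(3)[of e'] y(3)[of e'] have e': "x $ e' \<noteq> 0" "y $ e' \<noteq> 0" "(x + y) $ e' = 0"
    by auto
  have ne: "e \<noteq> e'"
    using e'(3) eq nz by auto
  let ?s = "x + y"
  have e: "\<bar>?s $ e\<bar> = 2"
    using x(3)[of e] eq nz by auto
  have flow: "incidence_matrix tail head *v ?s = 0"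
    using x y by (simp add: matrix_vector_right_distrib)
  have "card {e, e'} \<le> card (supp x \<inter> supp y)"
    using eq nz e' by (intro card_mono) auto
  \<comment> \<open>Two supports of size at most 3 share both \<open>e\<close> and
    \<open>e'\<close>.\<close>
  then have "card (supp x \<union> supp y) \<le> 4"
    using card_Un_Int[of "supp x" "supp y"] x(2) y(2) ne by simp
  moreover have "supp ?s \<subset> supp x \<union> supp y"
    using e' by auto
  then have "card (supp ?s) < card (supp x \<union> supp y)"
    by (intro psubset_card_mono) auto
  ultimately have "card (supp ?s) \<le> 3"
    by simp
  then have "\<bar>?s $ a\<bar> = 2" if "?s $ a \<noteq> 0" for a
    using flow_abs_eq[OF simple flow _ _ that, of e] e by simp
  \<comment> \<open>Since \<open>y $ a\<close> is at most 1 in absolute value, it cannot produce 2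
    alone.\<close>
  then have "x $ a \<noteq> 0" if "?s $ a \<noteq> 0" for a
    using that y(3)[of a] by fastforce
  then have "supp ?s \<subseteq> supp x"
    by blast
  with e' have "supp ?s \<subset> supp x"
    by auto
  then have "card (supp ?s) < card (supp x)"
    by (intro psubset_card_mono) auto
  moreover have "?s \<noteq> 0"
    using e by (metis abs_zero zero_index zero_neq_numeral)
  then have "3 \<le> card (supp ?s)"
    by (rule flow_card_supp_ge_3[OF simple flow])
  ultimately show False
    using x(2) by simp
qed

section \<open>The rank of the flow lattice of a complete graph\<close>

text \<open>The sign \<open>a\<close> corrects for the fixed orientation, so that the edge can be
  traversed from \<open>u\<close> to \<open>v\<close>.\<close>

lemma arc_vector:
  assumes complete: "complete_graph tail head" and "u \<noteq> v"
  obtains e a where "{tail e, head e} = {u, v}" "a \<in> \<int>"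
    "incidence_matrix tail head *v axis e a = axis v 1 - axis u 1"
proof -
  let ?I = "incidence_matrix tail head"
  obtain e where e: "{tail e, head e} = {u, v}"
    using assms unfolding complete_graph_def adjacent_def by blast
  have ne: "tail e \<noteq> head e"
    using complete by (auto simp: complete_graph_def simple_graph_def)
  have axis: "?I *v axis e a = a *s (axis (head e) 1 - axis (tail e) 1)" for a
    using ne by (auto simp: vec_eq_iff matrix_vector_mult_def incidence_matrix_def axis_def
        if_distrib[of "\<lambda>x. _ * x"] cong: if_cong)
  consider "tail e = u" "head e = v" | "tail e = v" "head e = u"
    using e ne by (auto simp: doubleton_eq_iff)
  then show thesis
  proof cases
    case 1
    then show thesis
      using axis[of 1] e by (intro that[of e 1]) auto
  next
    case 2
    then show thesis
      using axis[of "-1"] e by (intro that[of e "-1"]) auto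
  qed
qed

text \<open>Traverse the triangle on \<open>r\<close>, \<open>tail e\<close> and
  \<open>head e\<close> cyclically: the three boundaries telescope to 0, and the two edges other
  than \<open>e\<close> contain \<open>r\<close>.\<close>

lemma triangle_flow:
  assumes complete: "complete_graph tail head" and e: "r \<noteq> tail e" "r \<noteq> head e"
  obtains x where "x \<in> flow_lattice tail head"
    "\<And>e'. r \<notin> {tail e', head e'} \<Longrightarrow> x $ e' = axis e 1 $ e'"
proof -
  let ?I = "incidence_matrix tail head"
  have ne: "tail e \<noteq> head e"
    using complete by (auto simp: complete_graph_def simple_graph_def)
  obtain e1 a1 where e1: "{tail e1, head e1} = {r, tail e}" "a1 \<in> \<int>"
    "?I *v axis e1 a1 = axis (tail e) 1 - axis r 1"
    using arc_vector[OF complete e(1)] by metis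
  obtain e2 a2 where e2: "{tail e2, head e2} = {head e, r}" "a2 \<in> \<int>"
    "?I *v axis e2 a2 = axis r 1 - axis (head e) 1"
    using arc_vector[OF complete e(2)[symmetric]] by metis
  have e3: "?I *v axis e 1 = axis (head e) 1 - axis (tail e) 1"
    using ne by (auto simp: vec_eq_iff matrix_vector_mult_def incidence_matrix_def axis_def
        if_distrib[of "\<lambda>x. _ * x"] cong: if_cong)
  let ?x = "axis e1 a1 + axis e 1 + axis e2 a2"
  show thesis
  proof
    show "?x \<in> flow_lattice tail head"
      using e1(2) e2(2) unfolding flow_lattice_def
      by (auto simp: matrix_vector_right_distrib e1(3) e2(3) e3) (auto simp: axis_def)
    show "?x $ e' = axis e 1 $ e'" if "r \<notin> {tail e', head e'}" for e'
    proof -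
      have "e' \<noteq> e1" "e' \<noteq> e2"
        using that e1(1) e2(1) by auto
      then show ?thesis by (simp add: axis_def)
    qed
  qed
qed

text \<open>This transfers an integral basis to real linear algebra, where dimension bounds are
  available.\<close>

lemma int_span_subset_span: "int_module.span S \<subseteq> span S"
proof (rule int_module.span_minimal[OF span_superset])
  show "int_module.subspace (span S)"
    unfolding int_module.subspace_def by (auto simp: span_zero span_add span_scale)
qed

lemma card_edges_within:
  fixes tail head :: "'e::finite \<Rightarrow> 'v::finite"
  assumes complete: "complete_graph tail head"
  shows "card {e. {tail e, head e} \<subseteq> W} = card W choose 2"
proof -
  have "bij_betw (\<lambda>e. {tail e, head e}) {e. {tail e, head e} \<subseteq> W} {A. A \<subseteq> W \<and> card A = 2}"
  proof (rule bij_betw_imageI)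
    show "inj_on (\<lambda>e. {tail e, head e}) {e. {tail e, head e} \<subseteq> W}"
      using complete unfolding complete_graph_def simple_graph_def inj_on_def by blast
    show "(\<lambda>e. {tail e, head e}) ` {e. {tail e, head e} \<subseteq> W} = {A. A \<subseteq> W \<and> card A = 2}"
    proof (intro equalityI subsetI)
      fix A assume "A \<in> (\<lambda>e. {tail e, head e}) ` {e. {tail e, head e} \<subseteq> W}"
      then show "A \<in> {A. A \<subseteq> W \<and> card A = 2}"
        using complete by (auto simp: complete_graph_def simple_graph_def)
    next
      fix A assume "A \<in> {A. A \<subseteq> W \<and> card A = 2}"
      then obtain u v where A: "A = {u, v}" "u \<noteq> v" "A \<subseteq> W"
        by (auto simp: card_2_iff)
      then obtain e where "{tail e, head e} = A"
        using complete unfolding complete_graph_def adjacent_def by metis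
      with A(3) show "A \<in> (\<lambda>e. {tail e, head e}) ` {e. {tail e, head e} \<subseteq> W}"
        by blast
    qed
  qed
  then show ?thesis
    using n_subsets[of W 2] by (simp add: bij_betw_same_card)
qed

lemma flow_basis_card_ge:
  fixes f :: "'g::finite \<Rightarrow> real^'e::finite" and tail head :: "'e \<Rightarrow> 'v::finite"
  assumes complete: "complete_graph tail head" and basis: "flow_basis tail head f"
  shows "(CARD('v) - 1) choose 2 \<le> CARD('g)"
proof -
  obtain r :: 'v where True by simp
  define E where "E = {e. {tail e, head e} \<subseteq> UNIV - {r}}"
  \<comment> \<open>\<open>P\<close> forgets the edges at \<open>r\<close>, which turns each
    triangle flow through \<open>r\<close> into a unit vector. These unit vectors are independent
    and lie in the span of the projected basis.\<close>
  define P :: "real^'e \<Rightarrow> real^'e" where "P = (\<lambda>x. \<chi> e. if e \<in> E then x $ e else 0)"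
  have P: "linear P"
    by (rule linearI) (auto simp: P_def vec_eq_iff)
  have "(\<lambda>e. axis e 1) ` E \<subseteq> span (P ` range f)"
  proof
    fix y :: "real^'e" assume "y \<in> (\<lambda>e. axis e 1) ` E"
    then obtain e where e: "e \<in> E" "y = axis e 1" by blast
    then obtain x where x: "x \<in> flow_lattice tail head"
      "\<And>e'. r \<notin> {tail e', head e'} \<Longrightarrow> x $ e' = axis e 1 $ e'"
      using triangle_flow[OF complete, of r e] by (auto simp: E_def)
    have "P x = y"
      using x(2) e by (auto simp: P_def E_def vec_eq_iff axis_def)
    moreover have "x \<in> span (range f)"
      using x(1) basis int_span_subset_span unfolding flow_basis_def by blast
    ultimately show "y \<in> span (P ` range f)"
      unfolding linear_span_image[OF P] by blast
  qed
  moreover have "independent ((\<lambda>e. axis e (1::real)) ` E)"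
    by (rule independent_mono[OF independent_Basis]) (auto simp: Basis_vec_def)
  ultimately have "card ((\<lambda>e. axis e (1::real)) ` E) \<le> card (P ` range f)"
    by (intro independent_span_bound[THEN conjunct2]) auto
  also have "\<dots> \<le> card (range f)"
    by (simp add: card_image_le)
  also have "\<dots> \<le> CARD('g)"
    by (simp add: card_image_le)
  also have "card ((\<lambda>e. axis e (1::real)) ` E) = card E"
    by (intro card_image inj_onI) (simp add: axis_eq_axis)
  also have "card E = (CARD('v) - 1) choose 2"
    unfolding E_def card_edges_within[OF complete] by (simp add: card_Diff_singleton)
  finally show ?thesis .
qed

section \<open>Counting incidences between edges and basis elements\<close>

theorem proposition4p4:
  fixes tail head :: "'e::finite \<Rightarrow> 'v::finite"
    and f :: "'g::finite \<Rightarrow> real^'e"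
    and n :: nat
  assumes "simple_graph tail head" and "connected_graph tail head"
    and "complete_graph tail head" and "CARD('v) = n" and "n \<ge> 5"
    and "cycle_M_basis tail head f"
  shows "\<exists>i. card {e. f i $ e \<noteq> 0} > 3"
proof (rule ccontr)
  let ?I = "incidence_matrix tail head"
  assume "\<not> ?thesis"
  then have short: "card (supp (f i)) \<le> 3" for i
    by (simp add: not_less)
  have basis: "flow_basis tail head f" and M: "M_matrix (dual_laplacian f)"
    and cycle: "\<And>i. \<exists>vs. f i = cycle_vector tail head vs"
    using assms(6) unfolding cycle_M_basis_def flow_M_basis_def by auto
  have inj: "inj f" and indep: "int_module.independent (range f)"
    using basis by (auto simp: flow_basis_def)
  have entries: "f i $ e \<in> {-1, 0, 1}" for i e
    using cycle[of i] by (elim exE) (simp add: cycle_vector_def)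
  have "f i \<in> flow_lattice tail head" for i
    using basis int_module.span_superset[of "range f"] by (auto simp: flow_basis_def)
  then have flow: "?I *v f i = 0" for i
    by (simp add: flow_lattice_def)
  \<comment> \<open>The off-diagonal entries of the dual Laplacian are these inner products.\<close>
  have "(\<Sum>e\<in>UNIV. f i $ e * f j $ e) \<le> 0" if "i \<noteq> j" for i j
    using M that by (simp add: M_matrix_def Z_matrix_def dual_laplacian_def basis_matrix_def
        matrix_matrix_mult_def transpose_def)
  then have disagree: "f i $ e \<noteq> f j $ e" if "i \<noteq> j" "f i $ e \<noteq> 0" for i j e
    using that by (intro short_flows_disagree[OF assms(1)] flow short entries) auto

  define s where "s = (\<Sum>i\<in>UNIV. f i)"
  \<comment> \<open>Otherwise the basis would satisfy a relation with all coefficients 1.\<close>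
  have "s \<noteq> 0"
  proof
    assume "s = 0"
    then have "(\<Sum>x\<in>range f. of_int 1 *\<^sub>R x) = 0"
      using sum.reindex[OF inj, of "\<lambda>x. x"] by (simp add: s_def)
    then have "int_module.dependent (range f)"
      unfolding int_module.dependent_explicit
      by (intro exI[of _ "range f"] exI[of _ "\<lambda>_. 1"]) auto
    with indep show False by simp
  qed
  have "?I *v s = 0"
    unfolding s_def using flow by (simp add: linear_sum[OF matrix_vector_mul_linear])
  then have s: "3 \<le> card (supp s)"
    using flow_card_supp_ge_3[OF assms(1)] \<open>s \<noteq> 0\<close> by blast

  \<comment> \<open>The extra 1 is affordable: two basis elements on \<open>e\<close> carry opposite
    signs and cancel in \<open>s\<close>, so \<open>s $ e\<close> is nonzero only if exactly one
    uses \<open>e\<close>.\<close>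
  have edge: "card {i. f i $ e \<noteq> 0} + (if s $ e \<noteq> 0 then 1 else 0) \<le> 2" for e
  proof -
    let ?P = "{i. f i $ e = 1}" and ?N = "{i. f i $ e = -1}"
    have le: "card ?P \<le> 1" "card ?N \<le> 1"
      unfolding One_nat_def card_le_Suc0_iff_eq[OF finite]
      by (metis (mono_tags) disagree mem_Collect_eq zero_neq_one zero_neq_neg_one)+
    have "{i. f i $ e \<noteq> 0} = ?P \<union> ?N"
      using entries[of _ e] by auto
    then have card: "card {i. f i $ e \<noteq> 0} = card ?P + card ?N"
      by (simp add: card_Un_disjoint disjoint_iff)
    have "s $ e = (\<Sum>i\<in>UNIV. of_bool (f i $ e = 1) - of_bool (f i $ e = -1))"
      unfolding s_def sum_component using entries[of _ e] by (intro sum.cong) auto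
    also have "\<dots> = real (card ?P) - real (card ?N)"
      by (simp add: sum_subtractf of_bool_def sum.If_cases)
    finally show ?thesis
      using le card by auto
  qed
  have "3 * CARD('g) = (\<Sum>i\<in>(UNIV::'g set). 3)"
    by simp
  also have "\<dots> \<le> (\<Sum>i\<in>UNIV. card (supp (f i)))"
  proof (intro sum_mono flow_card_supp_ge_3[OF assms(1) flow] notI)
    fix i assume "f i = 0"
    then show False
      using indep int_module.dependent_zero[of "range f"] by (metis rangeI)
  qed
  \<comment> \<open>Incidences are counted by edges instead of by basis elements.\<close>
  also have "\<dots> = (\<Sum>e\<in>UNIV. card {i. f i $ e \<noteq> 0})"
    using sum.swap[of "\<lambda>i e. if f i $ e \<noteq> 0 then 1 else 0 :: nat" UNIV UNIV]
    by (simp add: sum.If_cases)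
  finally have "3 * CARD('g) + card (supp s)
      \<le> (\<Sum>e\<in>UNIV. card {i. f i $ e \<noteq> 0} + (if s $ e \<noteq> 0 then 1 else 0))"
    by (simp add: sum.distrib sum.If_cases)
  also have "\<dots> \<le> (\<Sum>e\<in>(UNIV::'e set). 2)"
    by (intro sum_mono edge)
  also have "\<dots> = 2 * (n choose 2)"
    using card_edges_within[OF assms(3), of UNIV] assms(4) by simp
  finally have count: "3 * ((n - 1) choose 2) + 3 \<le> 2 * (n choose 2)"
    using s flow_basis_card_ge[OF assms(3) basis] assms(4) by simp
  \<comment> \<open>This removes the truncated subtractions; the final inequality becomes
    \<open>(m + 1) * (m + 2) \<le> 0\<close>.\<close>
  obtain m where "n = m + 5"
    using assms(5) by (metis add.commute le_Suc_ex)
  have "2 * (k choose 2) = k * (k - 1)" for k :: nat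
    unfolding choose_two by (intro dvd_mult_div_cancel) (cases k; simp)
  from this[of n] this[of "n - 1"] have "2 * (n choose 2) = n * (n - 1)"
    "2 * ((n - 1) choose 2) = (n - 1) * (n - 2)"
    by (simp_all add: numeral_2_eq_2)
  with count have "3 * ((n - 1) * (n - 2)) + 6 \<le> 2 * (n * (n - 1))"
    by linarith
  with \<open>n = m + 5\<close> show False
    by (simp add: algebra_simps)
qed

end
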